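(* Let $f,g:\mathbb{R}\to\mathbb{R}$ satisfy: $f,g\in C^\infty(\mathbb{R})$; $f(0)=0$ and $f''(x)\ge 0$ for all $x\in\mathbb{R}$; $g(x)\ge 0$ for all $x\in\mathbb{R}$, and $g(x)=0$ if and only if $x=0$. Let $T>0$ and $s>3/2$. Then no non-trivial (not identically vanishing) solution $u\in C^0([0,T];H^s(\mathbb{R}))$ of $$u_t+f'(u)u_x+\partial_x\Lambda^{-2}\Big(g(u)+\frac{f''(u)}{2}u_x^2\Big)=0$$ can be compactly supported on $[0,T]\times\mathbb{R}$.
   Context: Functions are real-valued, $t$ denotes time and $x$ space. $\Lambda^{-2}=(1-\partial_x^2)^{-1}$ is the inverse Helmholtz operator: $\Lambda^{-2}h=p\ast h$ and $\partial_x\Lambda^{-2}h=(\partial_x p)\ast h$, where $p(x)=\tfrac12 e^{-|x|}$, $\partial_xp(x)=-\mathrm{sgn}(x)p(x)$ and $\ast$ is convolution in $x$. $H^s(\mathbb{R})$ is the usual Sobolev space. By local well-posedness theory such solutions also belong to $C^1([0,T];H^{s-1}(\mathbb{R}))$. *)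

theory Defs
  imports "HOL-Analysis.Analysis"
begin

definition smooth :: "(real \<Rightarrow> real) \<Rightarrow> bool" where
  "smooth f \<longleftrightarrow> (\<forall>n x. (deriv ^^ n) f differentiable (at x))"

text \<open>
  Sobolev spaces.  The Fourier transform of a square integrable function is the
  \<open>L\<^sup>2\<close>-limit of the transforms of its truncations to \<open>[-R, R]\<close> (Plancherel).  It is
  determined only up to null sets, hence the relational definition.  It is not normalised by
  a power of \<open>2\<pi>\<close>, which changes Sobolev norms only by a constant factor.
\<close>

definition square_integrable :: "(real \<Rightarrow> 'a::euclidean_space) \<Rightarrow> bool" where
  "square_integrable h \<longleftrightarrow>
     h \<in> borel_measurable lborel \<and> integrable lborel (\<lambda>x. (norm (h x))\<^sup>2)"

definition truncated_fourier :: "real \<Rightarrow> (real \<Rightarrow> real) \<Rightarrow> real \<Rightarrow> complex" where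
  "truncated_fourier R h \<xi> = (LINT x:{-R..R}|lborel. of_real (h x) * cis (- (x * \<xi>)))"

definition is_fourier_transform :: "(real \<Rightarrow> real) \<Rightarrow> (real \<Rightarrow> complex) \<Rightarrow> bool" where
  "is_fourier_transform h H \<longleftrightarrow> square_integrable H \<and>
     ((\<lambda>R. \<integral>\<^sup>+\<xi>. ennreal ((norm (H \<xi> - truncated_fourier R h \<xi>))\<^sup>2) \<partial>lborel) \<longlongrightarrow> 0) at_top"

definition fourier_transform :: "(real \<Rightarrow> real) \<Rightarrow> real \<Rightarrow> complex" where
  "fourier_transform h = (SOME H. is_fourier_transform h H)"

text \<open>
  The space \<open>H\<^sup>s(\<real>)\<close> for \<open>s \<ge> 0\<close>, where all its elements are square integrable.  By
  Plancherel's theorem the existence clause holds for every square integrable function; it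
  only guards the choice in the definition of the transform.  Elements are functions,
  not almost-everywhere classes.
\<close>

definition sobolev_space :: "real \<Rightarrow> (real \<Rightarrow> real) set" where
  "sobolev_space s = {h. square_integrable h \<and> (\<exists>H. is_fourier_transform h H) \<and>
     integrable lborel (\<lambda>\<xi>. (1 + \<xi>\<^sup>2) powr s * (norm (fourier_transform h \<xi>))\<^sup>2)}"

definition sobolev_norm :: "real \<Rightarrow> (real \<Rightarrow> real) \<Rightarrow> real" where
  "sobolev_norm s h =
     sqrt (LINT \<xi>|lborel. (1 + \<xi>\<^sup>2) powr s * (norm (fourier_transform h \<xi>))\<^sup>2)"

definition continuous_into_sobolev :: "real \<Rightarrow> real \<Rightarrow> (real \<Rightarrow> real \<Rightarrow> real) \<Rightarrow> bool" where
  "continuous_into_sobolev T s u \<longleftrightarrow>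
     (\<forall>t\<in>{0..T}. u t \<in> sobolev_space s) \<and>
     (\<forall>t\<in>{0..T}. ((\<lambda>\<tau>. sobolev_norm s (\<lambda>x. u \<tau> x - u t x)) \<longlongrightarrow> 0) (at t within {0..T}))"

definition helmholtz_kernel :: "real \<Rightarrow> real" where
  "helmholtz_kernel x = exp (- \<bar>x\<bar>) / 2"

text \<open>The operator \<open>\<partial>\<^sub>x(1 - \<partial>\<^sub>x\<^sup>2)\<^sup>-\<^sup>1\<close>, that is, convolution with the almost everywhere
  derivative \<open>-sgn(x) p(x)\<close> of the kernel \<open>p\<close> of \<open>(1 - \<partial>\<^sub>x\<^sup>2)\<^sup>-\<^sup>1\<close>.\<close>

definition dx_inverse_helmholtz :: "(real \<Rightarrow> real) \<Rightarrow> real \<Rightarrow> real" where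
  "dx_inverse_helmholtz h x =
     (LINT y|lborel. (- sgn (x - y) * helmholtz_kernel (x - y)) * h y)"

text \<open>
  For \<open>s > 3/2\<close> a solution in \<open>C\<^sup>0([0,T]; H\<^sup>s)\<close> also lies in \<open>C\<^sup>1([0,T]; H\<^sup>s\<^sup>-\<^sup>1)\<close>, so by the
  embeddings of \<open>H\<^sup>s\<close> in \<open>C\<^sup>1\<close> and of \<open>H\<^sup>s\<^sup>-\<^sup>1\<close> in \<open>C\<^sup>0\<close> its continuous representative satisfies
  the equation pointwise; the time derivative is one-sided at \<open>0\<close> and \<open>T\<close>.  Existence of
  the spatial derivative just selects that representative of \<open>u t\<close>.  No continuity of
  either derivative is demanded.
\<close>

definition solves_equation ::
    "(real \<Rightarrow> real) \<Rightarrow> (real \<Rightarrow> real) \<Rightarrow> real \<Rightarrow> (real \<Rightarrow> real \<Rightarrow> real) \<Rightarrow> bool" where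
  "solves_equation f g T u \<longleftrightarrow>
     (\<exists>u\<^sub>t u\<^sub>x. \<forall>t\<in>{0..T}. \<forall>x.
        ((\<lambda>\<tau>. u \<tau> x) has_real_derivative u\<^sub>t t x) (at t within {0..T}) \<and>
        (u t has_real_derivative u\<^sub>x t x) (at x) \<and>
        u\<^sub>t t x + deriv f (u t x) * u\<^sub>x t x
          + dx_inverse_helmholtz
              (\<lambda>y. g (u t y) + deriv (deriv f) (u t y) / 2 * (u\<^sub>x t y)\<^sup>2) x = 0)"

definition compactly_supported_on_strip :: "real \<Rightarrow> (real \<Rightarrow> real \<Rightarrow> real) \<Rightarrow> bool" where
  "compactly_supported_on_strip T u \<longleftrightarrow>
     compact (closure {(t, x). t \<in> {0..T} \<and> u t x \<noteq> 0})"

end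

theory Submission
  imports Defs "HOL-Probability.Characteristic_Functions"
begin

text \<open>
  To the right of the support of \<open>u t\<close> the equation reduces to
  \<open>e\<^sup>-\<^sup>x/2 \<cdot> \<integral> e\<^sup>y F(y) dy = 0\<close> for the nonnegative function \<open>F = g(u) + f''(u)/2 \<cdot> u\<^sub>x\<^sup>2\<close>, so
  \<open>F = 0\<close> almost everywhere, hence \<open>g(u) = 0\<close> and \<open>u = 0\<close>.  This needs \<open>F\<close> to be integrable
  (the integral of a non-integrable function is \<open>0\<close> by convention), that is \<open>u\<^sub>x \<in> L\<^sup>2\<close>, which
  must be extracted from the Fourier-side definition of \<open>H\<^sup>s\<close>.
\<close>

section \<open>Fourier integrals and functions of compact support\<close>

text \<open>A transform defined at every point, so that it can be computed with;
  \<open>fourier_transform\<close> is an unspecified choice, fixed only up to null sets. The two are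
  compared below for functions of compact support.\<close>

definition fourier_integral :: "(real \<Rightarrow> real) \<Rightarrow> real \<Rightarrow> complex" where
  "fourier_integral h \<xi> = (LINT x|lborel. of_real (h x) * cis (- (x * \<xi>)))"

lemma measurable_cis [measurable]: "cis \<in> borel_measurable borel"
  by (intro borel_measurable_continuous_onI continuous_intros)

lemma measurable_cnj [measurable]: "cnj \<in> borel_measurable borel"
  by (intro borel_measurable_continuous_onI continuous_intros)

lemma continuous_compact_support_integrable:
  fixes k :: "real \<Rightarrow> real"
  assumes cont: "continuous_on UNIV k" and supp: "\<And>x. \<bar>x\<bar> > R \<Longrightarrow> k x = 0"
  shows "integrable lborel k"
proof -
  have "set_integrable lborel {-R..R} k"
    by (rule borel_integrable_atLeastAtMost') (rule continuous_on_subset[OF cont], simp)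
  moreover have "(\<lambda>x. indicator {-R..R} x *\<^sub>R k x) = k"
  proof
    show "indicator {-R..R} x *\<^sub>R k x = k x" for x
      using supp[of x] by (cases "\<bar>x\<bar> > R") (auto simp: abs_le_iff not_less)
  qed
  ultimately show ?thesis
    by (simp add: set_integrable_def)
qed

lemma continuous_compact_support_bounded:
  fixes k :: "real \<Rightarrow> real"
  assumes cont: "continuous_on UNIV k" and supp: "\<And>x. \<bar>x\<bar> > R \<Longrightarrow> k x = 0"
  obtains B where "B \<ge> 0" "\<And>x. \<bar>k x\<bar> \<le> B"
proof -
  have "bounded (k ` {-R..R})"
    by (intro compact_imp_bounded compact_continuous_image continuous_on_subset[OF cont]) auto
  then obtain B where B: "\<And>x. x \<in> {-R..R} \<Longrightarrow> \<bar>k x\<bar> \<le> B"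
    unfolding bounded_iff by (metis image_eqI real_norm_def)
  \<comment> \<open>The maximum with 0 covers the points outside the interval, and the case of
    negative \<open>R\<close>, where the interval is empty and \<open>B\<close> carries no
    information.\<close>
  have "\<bar>k x\<bar> \<le> max B 0" for x
    using B[of x] supp[of x] by (cases "\<bar>x\<bar> > R") (auto simp: le_max_iff_disj abs_le_iff not_less)
  then show ?thesis
    by (intro that[of "max B 0"]) auto
qed

text \<open>Domination by a multiple of the integrable product of \<open>f\<close> and
  \<open>g\<close>. It supplies the integrability that Fubini requires for both exchanges of
  integrals in \<open>gaussian_average_fourier\<close>.\<close>

lemma integrable_pair_mult_bounded:
  fixes f g :: "real \<Rightarrow> real" and b :: "real \<Rightarrow> real \<Rightarrow> complex"
  assumes f: "integrable lborel f" and g: "integrable lborel g"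
    and b [measurable]: "(\<lambda>(x, y). b x y) \<in> borel_measurable (lborel \<Otimes>\<^sub>M lborel)"
    and bound: "\<And>x y. norm (b x y) \<le> B"
  shows "integrable (lborel \<Otimes>\<^sub>M lborel) (\<lambda>(x, y). of_real (f x) * of_real (g y) * b x y)"
proof -
  interpret lborel_pair: pair_sigma_finite "lborel :: real measure" "lborel :: real measure" ..
  have [measurable]: "f \<in> borel_measurable borel" "g \<in> borel_measurable borel"
    using f g by (auto dest: borel_measurable_integrable)
  have "integrable (lborel \<Otimes>\<^sub>M lborel) (\<lambda>z. f (fst z) * g (snd z))"
    by (rule lborel_pair.Fubini_integrable) (use f g in \<open>auto simp: abs_mult\<close>)
  then have "integrable (lborel \<Otimes>\<^sub>M lborel) (\<lambda>z. B * (f (fst z) * g (snd z)))"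
    by (rule integrable_mult_right)
  then show ?thesis
  proof (rule Bochner_Integration.integrable_bound)
    show "AE z in lborel \<Otimes>\<^sub>M lborel. norm (case z of (x, y) \<Rightarrow> of_real (f x) * of_real (g y) * b x y)
      \<le> norm (B * (f (fst z) * g (snd z)))"
    proof (rule AE_I2, clarify)
      fix x y :: real
      have "norm (b x y) * (\<bar>f x\<bar> * \<bar>g y\<bar>) \<le> \<bar>B\<bar> * (\<bar>f x\<bar> * \<bar>g y\<bar>)"
        using bound[of x y] by (intro mult_right_mono) auto
      then show "norm (of_real (f x) * of_real (g y) * b x y) \<le> norm (B * (f (fst (x, y)) * g (snd (x, y))))"
        by (simp add: norm_mult abs_mult mult_ac)
    qed
  qed simp
qed

lemma measurable_fourier_integral [measurable]:
  assumes [measurable]: "h \<in> borel_measurable borel"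
  shows "fourier_integral h \<in> borel_measurable borel"
  unfolding fourier_integral_def[abs_def] by measurable

lemma norm_fourier_integral_le:
  assumes "integrable lborel h"
  shows "norm (fourier_integral h \<xi>) \<le> (LINT x|lborel. \<bar>h x\<bar>)"
  unfolding fourier_integral_def
  by (rule order_trans[OF integral_norm_bound]) (simp add: norm_mult)

section \<open>Gaussian averages and one half of Plancherel's theorem\<close>

text \<open>The left side is the characteristic function of the standard normal distribution, whose
  value is known from probability theory.\<close>

lemma integral_std_normal_cis:
  "(LINT \<xi>|lborel. of_real (std_normal_density \<xi>) * cis (a * \<xi>)) = of_real (exp (- a\<^sup>2 / 2))"
proof -
  have "char std_normal_distribution a = (LINT \<xi>|lborel. std_normal_density \<xi> *\<^sub>R cis (a * \<xi>))"
    unfolding char_def by (subst integral_density) (auto simp: cis_conv_exp)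
  then show ?thesis
    by (simp add: char_std_normal_distribution scaleR_conv_of_real)
qed

text \<open>The squared modulus is the transform times its conjugate. Both are written as integrals
  and the integral over \<xi> is done first, which leaves the transform of the Gaussian at
  \<open>c * (y - x)\<close>. As \<open>c\<close> grows, the window widens in frequency and narrows
  in space.\<close>

lemma gaussian_average_fourier:
  fixes k :: "real \<Rightarrow> real"
  assumes k: "integrable lborel k"
  shows "(LINT \<xi>|lborel. std_normal_density \<xi> * (norm (fourier_integral k (c * \<xi>)))\<^sup>2)
    = (LINT x|lborel. k x * (LINT y|lborel. k y * exp (- (c * (y - x))\<^sup>2 / 2)))"
proof -
  interpret lborel_pair: pair_sigma_finite "lborel :: real measure" "lborel :: real measure" ..
  let ?\<phi> = std_normal_density
  let ?F = "fourier_integral k"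
  have \<phi>: "integrable lborel ?\<phi>"
    using integrable_normal_density[of 1 0] by simp
  have [measurable]: "k \<in> borel_measurable borel"
    using k by (auto dest: borel_measurable_integrable)
  \<comment> \<open>For fixed \<open>x\<close> the conjugate transform is expanded; the two phases
    merge into one depending on \<open>y - x\<close>, so that after an exchange the integral over
    \<xi> is Gaussian.\<close>
  have inner: "(LINT \<xi>|lborel. of_real (?\<phi> \<xi>) * cis (- (x * (c * \<xi>))) * cnj (?F (c * \<xi>)))
      = of_real (LINT y|lborel. k y * exp (- (c * (y - x))\<^sup>2 / 2))" for x
  proof -
    have "(LINT \<xi>|lborel. of_real (?\<phi> \<xi>) * cis (- (x * (c * \<xi>))) * cnj (?F (c * \<xi>)))
      = (LINT \<xi>|lborel. LINT y|lborel. of_real (k y) * of_real (?\<phi> \<xi>) * cis ((c * (y - x)) * \<xi>))"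
    proof (rule Bochner_Integration.integral_cong[OF refl])
      fix \<xi>
      have "cnj (?F (c * \<xi>)) = (LINT y|lborel. of_real (k y) * cis (y * (c * \<xi>)))"
        unfolding fourier_integral_def
        by (simp add: cis_cnj flip: Bochner_Integration.integral_cnj)
      then have "of_real (?\<phi> \<xi>) * cis (- (x * (c * \<xi>))) * cnj (?F (c * \<xi>))
        = (LINT y|lborel. of_real (?\<phi> \<xi>) * cis (- (x * (c * \<xi>))) * (of_real (k y) * cis (y * (c * \<xi>))))"
        by simp
      also have "\<dots> = (LINT y|lborel. of_real (k y) * of_real (?\<phi> \<xi>) * cis ((c * (y - x)) * \<xi>))"
      proof (rule Bochner_Integration.integral_cong[OF refl])
        fix y
        have "cis ((c * (y - x)) * \<xi>) = cis (- (x * (c * \<xi>))) * cis (y * (c * \<xi>))"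
          by (simp add: cis_mult algebra_simps)
        then show "of_real (?\<phi> \<xi>) * cis (- (x * (c * \<xi>))) * (of_real (k y) * cis (y * (c * \<xi>)))
          = of_real (k y) * of_real (?\<phi> \<xi>) * cis ((c * (y - x)) * \<xi>)"
          by (simp add: mult_ac)
      qed
      finally show "of_real (?\<phi> \<xi>) * cis (- (x * (c * \<xi>))) * cnj (?F (c * \<xi>))
        = (LINT y|lborel. of_real (k y) * of_real (?\<phi> \<xi>) * cis ((c * (y - x)) * \<xi>))" .
    qed
    also have "\<dots> = (LINT y|lborel. LINT \<xi>|lborel. of_real (k y) * of_real (?\<phi> \<xi>) * cis ((c * (y - x)) * \<xi>))"
      by (rule lborel_pair.Fubini_integral, rule integrable_pair_mult_bounded[OF k \<phi>, of _ 1]) auto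
    also have "\<dots> = (LINT y|lborel. of_real (k y * exp (- (c * (y - x))\<^sup>2 / 2)))"
      by (simp add: mult.assoc[of "of_real (k _)"] integral_std_normal_cis)
    finally show ?thesis
      by (simp only: integral_complex_of_real)
  qed
  have "complex_of_real (LINT \<xi>|lborel. ?\<phi> \<xi> * (norm (?F (c * \<xi>)))\<^sup>2)
    = (LINT \<xi>|lborel. of_real (?\<phi> \<xi>) * (?F (c * \<xi>) * cnj (?F (c * \<xi>))))"
    by (subst integral_complex_of_real[symmetric])
       (simp add: complex_norm_square[symmetric] flip: of_real_power)
  also have "\<dots> = (LINT \<xi>|lborel. LINT x|lborel. of_real (k x) * of_real (?\<phi> \<xi>) *
      (cis (- (x * (c * \<xi>))) * cnj (?F (c * \<xi>))))"
  proof (rule Bochner_Integration.integral_cong[OF refl])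
    fix \<xi>
    have "of_real (?\<phi> \<xi>) * (?F (c * \<xi>) * cnj (?F (c * \<xi>)))
      = (of_real (?\<phi> \<xi>) * cnj (?F (c * \<xi>))) * ?F (c * \<xi>)"
      by (simp add: mult_ac)
    also have "\<dots> = (LINT x|lborel. (of_real (?\<phi> \<xi>) * cnj (?F (c * \<xi>))) * (of_real (k x) * cis (- (x * (c * \<xi>)))))"
      by (subst (2) fourier_integral_def) simp
    finally show "of_real (?\<phi> \<xi>) * (?F (c * \<xi>) * cnj (?F (c * \<xi>)))
      = (LINT x|lborel. of_real (k x) * of_real (?\<phi> \<xi>) * (cis (- (x * (c * \<xi>))) * cnj (?F (c * \<xi>))))"
      by (simp add: mult_ac)
  qed
  \<comment> \<open>The conjugate transform is kept as part of the bounded factor: its modulus is at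
    most the \<open>L1\<close> norm of \<open>k\<close>.\<close>
  also have "\<dots> = (LINT x|lborel. LINT \<xi>|lborel. of_real (k x) * of_real (?\<phi> \<xi>) *
      (cis (- (x * (c * \<xi>))) * cnj (?F (c * \<xi>))))"
    by (rule lborel_pair.Fubini_integral,
        rule integrable_pair_mult_bounded[OF k \<phi>, of _ "LINT x|lborel. \<bar>k x\<bar>"])
       (measurable, simp add: norm_mult norm_fourier_integral_le[OF k])
  also have "\<dots> = (LINT x|lborel. of_real (k x * (LINT y|lborel. k y * exp (- (c * (y - x))\<^sup>2 / 2))))"
    using inner by (simp add: mult.assoc)
  finally show ?thesis
    by (simp only: integral_complex_of_real of_real_eq_iff)
qed

text \<open>Half of Plancherel's theorem: averaging \<open>\<bar>F k\<bar>\<^sup>2\<close> against ever wider Gaussians turns it,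
  by Fubini, into \<open>k\<close> paired with its convolution by an approximate identity.\<close>

lemma plancherel_inequality:
  fixes k :: "real \<Rightarrow> real"
  assumes cont: "continuous_on UNIV k" and supp: "\<And>x. \<bar>x\<bar> > R \<Longrightarrow> k x = 0"
    and int: "integrable lborel (\<lambda>\<xi>. (norm (fourier_integral k \<xi>))\<^sup>2)"
  shows "2 * pi * (LINT x|lborel. (k x)\<^sup>2) \<le> (LINT \<xi>|lborel. (norm (fourier_integral k \<xi>))\<^sup>2)"
proof -
  let ?\<phi> = std_normal_density
  let ?I = "LINT \<xi>|lborel. (norm (fourier_integral k \<xi>))\<^sup>2"
  have k: "integrable lborel k"
    by (rule continuous_compact_support_integrable[OF cont supp])
  obtain B where B: "B \<ge> 0" "\<And>x. \<bar>k x\<bar> \<le> B"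
    using continuous_compact_support_bounded[OF cont supp] by blast
  have [measurable]: "k \<in> borel_measurable borel"
    using k by (auto dest: borel_measurable_integrable)
  have \<phi>: "integrable lborel ?\<phi>" and \<phi>1: "(LINT z|lborel. ?\<phi> z) = 1"
    using integrable_normal_density[of 1 0] integral_normal_density[of 1 0] by simp_all
  have exp_eq: "exp (- z\<^sup>2 / 2) = sqrt (2 * pi) * ?\<phi> z" for z
    by (simp add: std_normal_density_def)
  \<comment> \<open>The mean of \<open>k\<close> around \<open>x\<close> under a normal law of
    standard deviation \<open>1 / (n + 1)\<close>. The scaling sits in the argument of
    \<open>k\<close>, so that the dominating function \<open>B * ?\<phi> z\<close> does not depend
    on \<open>n\<close>.\<close>
  define J where "J n x = (LINT z|lborel. k (x + z / real (Suc n)) * ?\<phi> z)" for n x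
  have [measurable]: "J n \<in> borel_measurable borel" for n
    unfolding J_def[abs_def] by measurable
  have J_bound: "\<bar>J n x\<bar> \<le> B" for n x
  proof -
    have "norm (J n x) \<le> (LINT z|lborel. B * ?\<phi> z)"
      unfolding J_def
    proof (rule Bochner_Integration.integral_norm_bound_integral)
      show "integrable lborel (\<lambda>z. B * ?\<phi> z)" using \<phi> by simp
      show bd: "norm (k (x + z / real (Suc n)) * ?\<phi> z) \<le> B * ?\<phi> z" for z
        using B(2)[of "x + z / real (Suc n)"] by (simp add: abs_mult mult_right_mono)
      show "integrable lborel (\<lambda>z. k (x + z / real (Suc n)) * ?\<phi> z)"
        by (rule Bochner_Integration.integrable_bound[of _ "\<lambda>z. B * ?\<phi> z"])
           (use \<phi> bd B in \<open>auto simp del: of_nat_Suc\<close>)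
    qed
    then show ?thesis using \<phi>1 by simp
  qed
  have J_lim: "(\<lambda>n. J n x) \<longlonglongrightarrow> k x" for x
  proof -
    have "(\<lambda>n. J n x) \<longlonglongrightarrow> (LINT z|lborel. k x * ?\<phi> z)"
      unfolding J_def
    proof (rule integral_dominated_convergence[where w = "\<lambda>z. B * ?\<phi> z"])
      show "AE z in lborel. (\<lambda>n. k (x + z / real (Suc n)) * ?\<phi> z) \<longlonglongrightarrow> k x * ?\<phi> z"
      proof (intro AE_I2 tendsto_mult tendsto_const)
        fix z
        have "(\<lambda>n. x + z / real (Suc n)) \<longlonglongrightarrow> x + 0"
          by (intro tendsto_intros filterlim_compose[OF lim_const_over_n] LIMSEQ_Suc) real_asymp
        then show "(\<lambda>n. k (x + z / real (Suc n))) \<longlonglongrightarrow> k x"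
          using cont by (intro continuous_on_tendsto_compose[OF cont]) auto
      qed
      show "AE z in lborel. norm (k (x + z / real (Suc n)) * ?\<phi> z) \<le> B * ?\<phi> z" for n
        using B(2) by (simp add: abs_mult mult_right_mono)
    qed (use \<phi> in auto)
    then show ?thesis using \<phi>1 by simp
  qed
  have lim: "(\<lambda>n. LINT x|lborel. k x * J n x) \<longlonglongrightarrow> (LINT x|lborel. k x * k x)"
  proof (rule integral_dominated_convergence[where w = "\<lambda>x. \<bar>k x\<bar> * B"])
    show "AE x in lborel. (\<lambda>n. k x * J n x) \<longlonglongrightarrow> k x * k x"
      using J_lim by (intro AE_I2 tendsto_intros) auto
    show "AE x in lborel. norm (k x * J n x) \<le> \<bar>k x\<bar> * B" for n
      using J_bound by (simp add: abs_mult mult_left_mono)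
  qed (use k in auto)
  have "2 * pi * (LINT x|lborel. k x * J n x) \<le> ?I" for n
  proof -
    let ?c = "real (Suc n)"
    have c: "?c > 0" by simp
    \<comment> \<open>Substituting \<open>y = x + z / ?c\<close> yields the Jacobian
      \<open>1 / ?c\<close>; the factor \<open>sqrt (2 * pi)\<close> normalises the
      Gaussian.\<close>
    have J_eq: "(LINT y|lborel. k y * exp (- (?c * (y - x))\<^sup>2 / 2)) = sqrt (2 * pi) / ?c * J n x" for x
    proof -
      have "(LINT y|lborel. k y * exp (- (?c * (y - x))\<^sup>2 / 2))
        = \<bar>1 / ?c\<bar> *\<^sub>R (LINT z|lborel. k (x + 1 / ?c * z) * exp (- (?c * ((x + 1 / ?c * z) - x))\<^sup>2 / 2))"
        by (rule lborel_integral_real_affine) (use c in simp)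
      also have "\<dots> = 1 / ?c * (LINT z|lborel. k (x + z / ?c) * exp (- z\<^sup>2 / 2))"
        using c by (simp del: of_nat_Suc)
      also have "\<dots> = 1 / ?c * (sqrt (2 * pi) * J n x)"
        unfolding J_def exp_eq by (simp add: mult.left_commute del: of_nat_Suc)
      finally show ?thesis by simp
    qed
    \<comment> \<open>The density is at most its peak value \<open>1 / sqrt (2 * pi)\<close>, and
      rescaling \<xi> gives a factor \<open>1 / ?c\<close>. This cancels against the one in
      \<open>J_eq\<close>, so the final bound is uniform in \<open>n\<close>.\<close>
    have "(LINT \<xi>|lborel. ?\<phi> \<xi> * (norm (fourier_integral k (?c * \<xi>)))\<^sup>2)
       \<le> (LINT \<xi>|lborel. 1 / sqrt (2 * pi) * (norm (fourier_integral k (0 + ?c * \<xi>)))\<^sup>2)"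
    proof (rule integral_mono_AE')
      show "integrable lborel (\<lambda>\<xi>. 1 / sqrt (2 * pi) * (norm (fourier_integral k (0 + ?c * \<xi>)))\<^sup>2)"
        by (intro integrable_mult_right lborel_integrable_real_affine[OF int]) (use c in simp)
      show "AE \<xi> in lborel. ?\<phi> \<xi> * (norm (fourier_integral k (?c * \<xi>)))\<^sup>2
          \<le> 1 / sqrt (2 * pi) * (norm (fourier_integral k (0 + ?c * \<xi>)))\<^sup>2"
        by (intro AE_I2 mult_mono) (auto simp: std_normal_density_def divide_right_mono)
    qed auto
    also have "\<dots> = 1 / sqrt (2 * pi) * (?I / ?c)"
      using lborel_integral_real_affine[of ?c "\<lambda>\<xi>. (norm (fourier_integral k \<xi>))\<^sup>2" 0] c
      by (simp add: field_simps del: of_nat_Suc)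
    finally have "sqrt (2 * pi) / ?c * (LINT x|lborel. k x * J n x) \<le> 1 / sqrt (2 * pi) * (?I / ?c)"
      unfolding gaussian_average_fourier[OF k] J_eq
      by (simp only: mult.left_commute[of "k _"] integral_mult_right_zero)
    then have "(sqrt (2 * pi) * sqrt (2 * pi)) * (LINT x|lborel. k x * J n x) \<le> ?I"
      using c by (simp add: field_simps del: of_nat_Suc real_sqrt_mult_self)
    then show ?thesis by simp
  qed
  then have "2 * pi * (LINT x|lborel. k x * k x) \<le> ?I"
    by (intro LIMSEQ_le_const2[OF tendsto_mult[OF tendsto_const lim]]) auto
  then show ?thesis by (simp add: power2_eq_square)
qed

section \<open>From the Sobolev condition to the Fourier integral\<close>

text \<open>For \<open>r \<ge> R\<close> the truncated transform already equals the full integral,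
  so the squared \<open>L2\<close> distance to \<open>H\<close> is eventually constant in
  \<open>r\<close>. Its limit is 0, hence so is that constant.\<close>

lemma fourier_transform_AE_eq:
  assumes meas [measurable]: "h \<in> borel_measurable borel" and supp: "\<And>x. \<bar>x\<bar> > R \<Longrightarrow> h x = 0"
    and H: "is_fourier_transform h H"
  shows "AE \<xi> in lborel. H \<xi> = fourier_integral h \<xi>"
proof -
  have [measurable]: "H \<in> borel_measurable borel"
    using H by (simp add: is_fourier_transform_def square_integrable_def)
  let ?c = "\<integral>\<^sup>+\<xi>. ennreal ((norm (H \<xi> - fourier_integral h \<xi>))\<^sup>2) \<partial>lborel"
  have "truncated_fourier r h = fourier_integral h" if "r \<ge> R" for r
  proof
    fix \<xi>
    have "h x = 0" if "x \<notin> {-r..r}" for x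
      using that \<open>r \<ge> R\<close> by (intro supp) (auto simp: abs_if)
    then show "truncated_fourier r h \<xi> = fourier_integral h \<xi>"
      unfolding truncated_fourier_def fourier_integral_def set_lebesgue_integral_def
      by (intro Bochner_Integration.integral_cong) (auto simp: indicator_def)
  qed
  then have "\<forall>\<^sub>F r in at_top. (\<integral>\<^sup>+\<xi>. ennreal ((norm (H \<xi> - truncated_fourier r h \<xi>))\<^sup>2) \<partial>lborel) = ?c"
    by (intro eventually_mono[OF eventually_ge_at_top[of R]]) simp
  then have "((\<lambda>r. \<integral>\<^sup>+\<xi>. ennreal ((norm (H \<xi> - truncated_fourier r h \<xi>))\<^sup>2) \<partial>lborel) \<longlongrightarrow> ?c) at_top"
    by (rule tendsto_eventually)
  moreover have "((\<lambda>r. \<integral>\<^sup>+\<xi>. ennreal ((norm (H \<xi> - truncated_fourier r h \<xi>))\<^sup>2) \<partial>lborel) \<longlongrightarrow> 0) at_top"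
    using H by (simp add: is_fourier_transform_def)
  ultimately have "?c = 0"
    by (rule tendsto_unique[OF trivial_limit_at_top_linorder])
  then have "AE \<xi> in lborel. ennreal ((norm (H \<xi> - fourier_integral h \<xi>))\<^sup>2) = 0"
    by (subst (asm) nn_integral_0_iff_AE) auto
  then show ?thesis
    by eventually_elim (simp add: ennreal_eq_0_iff)
qed

text \<open>The Sobolev weight dominates \<open>\<xi>\<^sup>2\<close> once \<open>s \<ge> 1\<close>,
  and the compact support lets the explicit integral replace the chosen transform almost
  everywhere.\<close>

lemma sobolev_weighted_fourier_integrable:
  assumes "s \<ge> 1" and h: "h \<in> sobolev_space s" and supp: "\<And>x. \<bar>x\<bar> > R \<Longrightarrow> h x = 0"
  shows "integrable lborel (\<lambda>\<xi>. \<xi>\<^sup>2 * (norm (fourier_integral h \<xi>))\<^sup>2)"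
proof -
  have [measurable]: "h \<in> borel_measurable borel"
    using h by (simp add: sobolev_space_def square_integrable_def)
  have "is_fourier_transform h (fourier_transform h)"
    using h unfolding fourier_transform_def by (simp add: sobolev_space_def someI_ex)
  then have eq: "AE \<xi> in lborel. fourier_transform h \<xi> = fourier_integral h \<xi>"
    by (intro fourier_transform_AE_eq[OF _ supp]) auto
  have weight: "\<xi>\<^sup>2 \<le> (1 + \<xi>\<^sup>2) powr s" for \<xi> :: real
  proof -
    have "(1 + \<xi>\<^sup>2) powr 1 \<le> (1 + \<xi>\<^sup>2) powr s"
      using \<open>s \<ge> 1\<close> by (intro powr_mono) auto
    then show ?thesis by simp
  qed
  have "integrable lborel (\<lambda>\<xi>. (1 + \<xi>\<^sup>2) powr s * (norm (fourier_transform h \<xi>))\<^sup>2)"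
    using h by (simp add: sobolev_space_def)
  then show ?thesis
  proof (rule Bochner_Integration.integrable_bound)
    show "AE \<xi> in lborel. norm (\<xi>\<^sup>2 * (norm (fourier_integral h \<xi>))\<^sup>2)
      \<le> norm ((1 + \<xi>\<^sup>2) powr s * (norm (fourier_transform h \<xi>))\<^sup>2)"
      using eq by eventually_elim (simp add: mult_right_mono weight)
  qed simp
qed

section \<open>Difference quotients and square integrability of the derivative\<close>

lemma fourier_integral_translate:
  "fourier_integral (\<lambda>x. h (x + d)) \<xi> = cis (d * \<xi>) * fourier_integral h \<xi>"
proof -
  have "fourier_integral h \<xi>
    = \<bar>1\<bar> *\<^sub>R (LINT x|lborel. of_real (h (d + 1 * x)) * cis (- ((d + 1 * x) * \<xi>)))"
    unfolding fourier_integral_def by (rule lborel_integral_real_affine) simp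
  also have "\<dots> = (LINT x|lborel. cis (- (d * \<xi>)) * (of_real (h (x + d)) * cis (- (x * \<xi>))))"
  proof -
    have "cis (- ((d + x) * \<xi>)) = cis (- (d * \<xi>)) * cis (- (x * \<xi>))" for x
      by (simp add: cis_mult algebra_simps)
    then show ?thesis
      by (simp add: mult_ac add.commute del: mult_minus_left)
  qed
  also have "\<dots> = cis (- (d * \<xi>)) * fourier_integral (\<lambda>x. h (x + d)) \<xi>"
    by (simp add: fourier_integral_def)
  finally show ?thesis
    by (simp add: cis_mult flip: mult.assoc)
qed

text \<open>On the Fourier side the quotient is multiplication by
  \<open>(cis (d * \<xi>) - 1) / d\<close>, whose modulus is at most
  \<open>\<bar>\<xi>\<bar>\<close> for every step \<open>d\<close>.\<close>

lemma norm_fourier_difference_quotient_le: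
  assumes h: "integrable lborel h" and "d \<noteq> 0"
  shows "norm (fourier_integral (\<lambda>x. (h (x + d) - h x) / d) \<xi>) \<le> \<bar>\<xi>\<bar> * norm (fourier_integral h \<xi>)"
proof -
  have int: "integrable lborel (\<lambda>x. of_real (k x) * cis (- (x * \<xi>)))" if "integrable lborel k" for k
  proof (rule Bochner_Integration.integrable_bound[OF that])
    show "(\<lambda>x. of_real (k x) * cis (- (x * \<xi>))) \<in> borel_measurable lborel"
      using borel_measurable_integrable[OF that] by simp
  qed (simp add: norm_mult)
  have hd: "integrable lborel (\<lambda>x. h (x + d))"
    using lborel_integrable_real_affine[OF h, of 1 d] by (simp add: add.commute)
  have "fourier_integral (\<lambda>x. (h (x + d) - h x) / d) \<xi>
    = (LINT x|lborel. (of_real (h (x + d)) * cis (- (x * \<xi>)) - of_real (h x) * cis (- (x * \<xi>))) / of_real d)"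
    unfolding fourier_integral_def by (simp add: left_diff_distrib diff_divide_distrib)
  also have "\<dots> = (fourier_integral (\<lambda>x. h (x + d)) \<xi> - fourier_integral h \<xi>) / of_real d"
    using int[OF h] int[OF hd] by (simp add: fourier_integral_def)
  also have "\<dots> = (cis (d * \<xi>) - 1) / of_real d * fourier_integral h \<xi>"
    by (simp add: fourier_integral_translate left_diff_distrib)
  finally have "norm (fourier_integral (\<lambda>x. (h (x + d) - h x) / d) \<xi>)
    = norm (cis (d * \<xi>) - 1) / \<bar>d\<bar> * norm (fourier_integral h \<xi>)"
    by (simp add: norm_mult norm_divide)
  also have "\<dots> \<le> \<bar>\<xi>\<bar> * norm (fourier_integral h \<xi>)"
  proof (rule mult_right_mono)
    \<comment> \<open>This is the Taylor remainder estimate of order 0 for the imaginary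
      exponential.\<close>
    have "norm (cis (d * \<xi>) - 1) \<le> \<bar>d * \<xi>\<bar>"
      using iexp_approx1[of "d * \<xi>" 0] by (simp add: cis_conv_exp)
    then show "norm (cis (d * \<xi>) - 1) / \<bar>d\<bar> \<le> \<bar>\<xi>\<bar>"
      using \<open>d \<noteq> 0\<close> by (simp add: abs_mult field_simps)
  qed simp
  finally show ?thesis .
qed

text \<open>A sequence of steps is used because measurability of limits and Fatou's lemma concern
  sequences; \<open>Suc n\<close> keeps each step well defined and nonzero.\<close>

lemma derivative_difference_quotient_LIMSEQ:
  fixes h :: "real \<Rightarrow> real"
  assumes "(h has_real_derivative D) (at x)"
  shows "(\<lambda>n. (h (x + 1 / real (Suc n)) - h x) / (1 / real (Suc n))) \<longlonglongrightarrow> D"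
proof -
  have "((\<lambda>d. (h (x + d) - h x) / d) \<longlongrightarrow> D) (at 0)"
    using assms by (simp add: DERIV_def)
  moreover have "filterlim (\<lambda>n. 1 / real (Suc n)) (at 0) sequentially"
    unfolding filterlim_at by (intro conjI) (simp, real_asymp)
  ultimately show ?thesis
    by (rule filterlim_compose)
qed

lemma derivative_borel_measurable:
  fixes h h' :: "real \<Rightarrow> real"
  assumes deriv: "\<And>x. (h has_real_derivative h' x) (at x)"
  shows "h' \<in> borel_measurable borel"
proof (rule borel_measurable_LIMSEQ_real)
  have "continuous_on UNIV h"
    using deriv by (intro DERIV_continuous_on) (auto intro: DERIV_subset)
  then have [measurable]: "h \<in> borel_measurable borel"
    by (rule borel_measurable_continuous_onI)
  show "(\<lambda>x. (h (x + 1 / real (Suc n)) - h x) / (1 / real (Suc n))) \<in> borel_measurable borel" for n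
    by measurable
qed (rule derivative_difference_quotient_LIMSEQ[OF deriv])

text \<open>By Plancherel the difference quotients of \<open>h\<close> are bounded in \<open>L\<^sup>2\<close>; Fatou passes the
  bound on to the derivative.\<close>

lemma derivative_square_integrable:
  fixes h h' :: "real \<Rightarrow> real"
  assumes deriv: "\<And>x. (h has_real_derivative h' x) (at x)"
    and supp: "\<And>x. \<bar>x\<bar> > R \<Longrightarrow> h x = 0"
    and int: "integrable lborel (\<lambda>\<xi>. \<xi>\<^sup>2 * (norm (fourier_integral h \<xi>))\<^sup>2)"
  shows "integrable lborel (\<lambda>x. (h' x)\<^sup>2)"
proof -
  define C where "C = (LINT \<xi>|lborel. \<xi>\<^sup>2 * (norm (fourier_integral h \<xi>))\<^sup>2) / (2 * pi)"
  define k where "k n x = (h (x + 1 / real (Suc n)) - h x) / (1 / real (Suc n))" for n x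
  have cont: "continuous_on UNIV h"
    using deriv by (intro DERIV_continuous_on) (auto intro: DERIV_subset)
  have h: "integrable lborel h"
    by (rule continuous_compact_support_integrable[OF cont supp])
  have [measurable]: "h' \<in> borel_measurable borel"
    by (rule derivative_borel_measurable[OF deriv])
  have k_cont: "continuous_on UNIV (k n)" for n
    unfolding k_def[abs_def] by (intro continuous_intros continuous_on_compose2[OF cont]) auto
  have [measurable]: "k n \<in> borel_measurable borel" for n
    by (rule borel_measurable_continuous_onI[OF k_cont])
  \<comment> \<open>Every step is at most 1, so beyond radius \<open>R + 1\<close> both sample
    points lie outside the support of \<open>h\<close>.\<close>
  have k_supp: "k n x = 0" if "\<bar>x\<bar> > R + 1" for n x
  proof -
    have "1 / real (Suc n) \<le> 1" by simp
    moreover have "1 / real (Suc n) > 0" by simp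
    ultimately have "\<bar>x + 1 / real (Suc n)\<bar> > R"
      using that by linarith
    then show ?thesis
      using that supp[of x] supp[of "x + 1 / real (Suc n)"] by (simp add: k_def)
  qed
  have k_bound: "(\<integral>\<^sup>+x. ennreal ((k n x)\<^sup>2) \<partial>lborel) \<le> ennreal C" for n
  proof -
    have le: "(norm (fourier_integral (k n) \<xi>))\<^sup>2 \<le> \<xi>\<^sup>2 * (norm (fourier_integral h \<xi>))\<^sup>2" for \<xi>
    proof -
      have "norm (fourier_integral (k n) \<xi>) \<le> \<bar>\<xi>\<bar> * norm (fourier_integral h \<xi>)"
        unfolding k_def[abs_def] by (rule norm_fourier_difference_quotient_le[OF h]) simp
      then have "(norm (fourier_integral (k n) \<xi>))\<^sup>2 \<le> (\<bar>\<xi>\<bar> * norm (fourier_integral h \<xi>))\<^sup>2"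
        by (intro power_mono) auto
      then show ?thesis by (simp add: power_mult_distrib)
    qed
    have int_k: "integrable lborel (\<lambda>\<xi>. (norm (fourier_integral (k n) \<xi>))\<^sup>2)"
      by (rule Bochner_Integration.integrable_bound[OF int]) (use le in \<open>auto simp: abs_mult\<close>)
    have "2 * pi * (LINT x|lborel. (k n x)\<^sup>2) \<le> (LINT \<xi>|lborel. (norm (fourier_integral (k n) \<xi>))\<^sup>2)"
      by (rule plancherel_inequality[OF k_cont k_supp int_k])
    also have "\<dots> \<le> (LINT \<xi>|lborel. \<xi>\<^sup>2 * (norm (fourier_integral h \<xi>))\<^sup>2)"
      by (rule integral_mono[OF int_k int le])
    finally have "(LINT x|lborel. (k n x)\<^sup>2) \<le> C"
      by (simp add: C_def field_simps)
    moreover have "integrable lborel (\<lambda>x. (k n x)\<^sup>2)"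
      by (rule continuous_compact_support_integrable[of _ "R + 1"])
         (auto intro!: continuous_intros k_cont simp: k_supp)
    ultimately show ?thesis
      by (subst nn_integral_eq_integral) (auto intro: ennreal_leI)
  qed
  have "(\<integral>\<^sup>+x. ennreal ((h' x)\<^sup>2) \<partial>lborel) = (\<integral>\<^sup>+x. liminf (\<lambda>n. ennreal ((k n x)\<^sup>2)) \<partial>lborel)"
  proof (rule nn_integral_cong)
    fix x
    have "(\<lambda>n. ennreal ((k n x)\<^sup>2)) \<longlonglongrightarrow> ennreal ((h' x)\<^sup>2)"
      unfolding k_def
      by (intro tendsto_ennrealI tendsto_power derivative_difference_quotient_LIMSEQ deriv)
    then show "ennreal ((h' x)\<^sup>2) = liminf (\<lambda>n. ennreal ((k n x)\<^sup>2))"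
      by (intro lim_imp_Liminf[symmetric]) auto
  qed
  also have "\<dots> \<le> liminf (\<lambda>n. \<integral>\<^sup>+x. ennreal ((k n x)\<^sup>2) \<partial>lborel)"
    by (rule nn_integral_liminf) simp
  also have "\<dots> \<le> ennreal C"
    using k_bound by (intro Liminf_le) auto
  finally have "(\<integral>\<^sup>+x. ennreal ((h' x)\<^sup>2) \<partial>lborel) < \<infinity>"
    by (rule order_le_less_trans) simp
  then show ?thesis
    by (intro integrableI_nonneg) auto
qed

section \<open>One-signed kernel to the right of the support, and the contradiction\<close>

lemma smooth_imp_continuous_deriv:
  assumes "smooth f"
  shows "continuous_on UNIV ((deriv ^^ n) f)"
  using assms unfolding smooth_def
  by (intro differentiable_imp_continuous_on) (simp add: differentiable_on_def)

text \<open>The zero set is closed and has full measure; its complement is an open null set, hence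
  empty.\<close>

lemma continuous_AE_zero_imp_zero:
  fixes h :: "real \<Rightarrow> real"
  assumes cont: "continuous_on UNIV h" and "AE x in lborel. h x = 0"
  shows "h x = 0"
proof -
  have "closed {x. h x = 0}"
    using cont by (intro closed_Collect_eq) auto
  moreover have "AE x in lebesgue. x \<in> {x. h x = 0}"
    using assms(2) by (intro AE_completion) simp
  ultimately show ?thesis
    using mem_closed_if_AE_lebesgue by blast
qed

text \<open>Seen from \<open>x\<close>, all the mass of \<open>F\<close> lies to the left, where the
  kernel is strictly negative. Nothing can cancel, so a vanishing convolution forces
  \<open>F\<close> to vanish.\<close>

lemma dx_inverse_helmholtz_zero_imp_AE_zero:
  assumes F: "integrable lborel F" and nonneg: "\<And>y. F y \<ge> 0"
    and supp: "\<And>y. y \<ge> x \<Longrightarrow> F y = 0"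
    and zero: "dx_inverse_helmholtz F x = 0"
  shows "AE y in lborel. F y = 0"
proof -
  have [measurable]: "F \<in> borel_measurable borel"
    using F by (auto dest: borel_measurable_integrable)
  \<comment> \<open>For \<open>y \<ge> x\<close>, including \<open>y = x\<close> where the sign is
    0, both sides vanish with \<open>F y\<close>; for \<open>y < x\<close> the sign is 1.\<close>
  have eq: "(- sgn (x - y) * helmholtz_kernel (x - y)) * F y = - (exp (- \<bar>x - y\<bar>) / 2 * F y)" for y
    using supp[of y] by (cases "y \<ge> x") (auto simp: helmholtz_kernel_def)
  have "integrable lborel (\<lambda>y. exp (- \<bar>x - y\<bar>) / 2 * F y)"
  proof (rule Bochner_Integration.integrable_bound[OF F])
    have "exp (- \<bar>x - y\<bar>) / 2 * F y \<le> 1 * F y" for y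
      using exp_le_one_iff[of "- \<bar>x - y\<bar>"] nonneg by (intro mult_right_mono) linarith+
    then show "AE y in lborel. norm (exp (- \<bar>x - y\<bar>) / 2 * F y) \<le> norm (F y)"
      using nonneg by (intro AE_I2) (simp add: abs_mult)
  qed simp
  moreover have "(LINT y|lborel. exp (- \<bar>x - y\<bar>) / 2 * F y) = 0"
    using zero unfolding dx_inverse_helmholtz_def eq by simp
  ultimately have "AE y in lborel. exp (- \<bar>x - y\<bar>) / 2 * F y = 0"
    using nonneg by (subst (asm) integral_nonneg_eq_0_iff_AE) auto
  then show ?thesis
    by eventually_elim simp
qed

theorem corollary2p3:
  fixes f g :: "real \<Rightarrow> real" and T s :: real and u :: "real \<Rightarrow> real \<Rightarrow> real"
  assumes "smooth f" and "smooth g"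
    and "f 0 = 0" and "\<forall>x. deriv (deriv f) x \<ge> 0"
    and "\<forall>x. g x \<ge> 0" and "\<forall>x. g x = 0 \<longleftrightarrow> x = 0"
    and "T > 0" and "s > 3 / 2"
    and "continuous_into_sobolev T s u"
    and "solves_equation f g T u"
    and "\<exists>t\<in>{0..T}. \<exists>x. u t x \<noteq> 0"
  shows "\<not> compactly_supported_on_strip T u"
proof
  assume "compactly_supported_on_strip T u"
  then have "bounded {(t, x). t \<in> {0..T} \<and> u t x \<noteq> 0}"
    unfolding compactly_supported_on_strip_def
    by (rule bounded_subset[OF compact_imp_bounded closure_subset])
  then obtain R where R: "\<And>t x. t \<in> {0..T} \<Longrightarrow> u t x \<noteq> 0 \<Longrightarrow> norm (t, x) \<le> R"
    unfolding bounded_iff by auto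
  \<comment> \<open>The norm of a pair dominates the modulus of each component, so one radius
    \<open>R\<close> serves all times in \<open>{0..T}\<close>.\<close>
  have supp: "u t x = 0" if "t \<in> {0..T}" "\<bar>x\<bar> > R" for t x
    using R[OF that(1), of x] norm_snd_le[of x t] that(2) by fastforce
  obtain t x\<^sub>0 where t: "t \<in> {0..T}" and "u t x\<^sub>0 \<noteq> 0"
    using assms(11) by blast
  obtain u\<^sub>t u\<^sub>x where
    dt: "\<And>x. ((\<lambda>\<tau>. u \<tau> x) has_real_derivative u\<^sub>t x) (at t within {0..T})" and
    dx: "\<And>x. (u t has_real_derivative u\<^sub>x x) (at x)" and
    eq: "\<And>x. u\<^sub>t x + deriv f (u t x) * u\<^sub>x x + dx_inverse_helmholtz
          (\<lambda>y. g (u t y) + deriv (deriv f) (u t y) / 2 * (u\<^sub>x y)\<^sup>2) x = 0"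
    using assms(10) t unfolding solves_equation_def by blast
  define F where "F y = g (u t y) + deriv (deriv f) (u t y) / 2 * (u\<^sub>x y)\<^sup>2" for y
  have u_cont: "continuous_on UNIV (u t)"
    using dx by (intro DERIV_continuous_on) (auto intro: DERIV_subset)
  have g_cont: "continuous_on UNIV (\<lambda>y. g (u t y))"
    using smooth_imp_continuous_deriv[OF assms(2), of 0]
    by (intro continuous_on_compose2[OF _ u_cont]) auto
  \<comment> \<open>Where \<open>u\<close> vanishes, the second derivative of \<open>f\<close> takes
    its value at 0, which may be positive. Subtracting that value gives a function of compact
    support, which is therefore bounded.\<close>
  have f_cont: "continuous_on UNIV (\<lambda>y. deriv (deriv f) (u t y) - deriv (deriv f) 0)"
    using smooth_imp_continuous_deriv[OF assms(1), of 2]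
    by (intro continuous_intros continuous_on_compose2[OF _ u_cont]) (auto simp: numeral_2_eq_2)
  have ux_zero: "u\<^sub>x x = 0" if "\<bar>x\<bar> > R" for x
  proof -
    have "\<forall>\<^sub>F y in nhds x. \<bar>y\<bar> > R"
      using that by (intro order_tendstoD[OF tendsto_rabs[OF filterlim_ident]])
    then have "\<forall>\<^sub>F y in nhds x. u t y = (\<lambda>_. 0) y"
      by eventually_elim (simp add: supp[OF t])
    then have "((\<lambda>_. 0) has_real_derivative u\<^sub>x x) (at x)"
      using dx[of x] by (subst (asm) DERIV_cong_ev[OF refl _ refl])
    then show ?thesis
      using DERIV_unique DERIV_const by blast
  qed
  \<comment> \<open>At such \<open>x\<close> the solution vanishes at all times in the interval. The
    derivative within \<open>{0..T}\<close>, one-sided at the ends, is unique since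
    \<open>T > 0\<close> makes \<open>t\<close> a limit point.\<close>
  have ut_zero: "u\<^sub>t x = 0" if "\<bar>x\<bar> > R" for x
  proof -
    have "((\<lambda>_. 0) has_real_derivative u\<^sub>t x) (at t within {0..T})"
      by (rule has_field_derivative_transform_within[OF dt[of x] zero_less_one t]) (simp add: supp that)
    moreover have "at t within {0..T} \<noteq> bot"
      using t \<open>T > 0\<close> by (simp add: trivial_limit_within islimpt_Icc)
    ultimately show ?thesis
      using has_field_derivative_unique DERIV_const by blast
  qed
  have F_nonneg: "F y \<ge> 0" for y
    using assms(4,5) by (simp add: F_def)
  have F_supp: "F y = 0" if "\<bar>y\<bar> > R" for y
    using that supp[OF t that] ux_zero assms(6) by (simp add: F_def)
  have ux_int: "integrable lborel (\<lambda>y. (u\<^sub>x y)\<^sup>2)"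
  proof (rule derivative_square_integrable[OF dx supp[OF t]])
    show "integrable lborel (\<lambda>\<xi>. \<xi>\<^sup>2 * (norm (fourier_integral (u t) \<xi>))\<^sup>2)"
      using assms(8,9) t
      by (intro sobolev_weighted_fourier_integrable[of s _ R] supp[OF t])
         (auto simp: continuous_into_sobolev_def)
  qed
  obtain B where B: "\<And>y. \<bar>deriv (deriv f) (u t y) - deriv (deriv f) 0\<bar> \<le> B"
  proof (rule continuous_compact_support_bounded[OF f_cont])
    show "deriv (deriv f) (u t y) - deriv (deriv f) 0 = 0" if "\<bar>y\<bar> > R" for y
      by (simp add: supp[OF t that])
  qed blast
  have F_int: "integrable lborel F"
  proof -
    have "integrable lborel (\<lambda>y. g (u t y))"
      using supp[OF t] assms(6)
      by (intro continuous_compact_support_integrable[OF g_cont, of R]) auto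
    moreover have "integrable lborel (\<lambda>y. deriv (deriv f) (u t y) / 2 * (u\<^sub>x y)\<^sup>2)"
    proof (rule Bochner_Integration.integrable_bound)
      show "integrable lborel (\<lambda>y. (B + deriv (deriv f) 0) / 2 * (u\<^sub>x y)\<^sup>2)"
        using ux_int by simp
      have "(\<lambda>y. (deriv (deriv f) (u t y) - deriv (deriv f) 0) + deriv (deriv f) 0) \<in> borel_measurable borel"
        by (intro borel_measurable_continuous_onI continuous_intros f_cont)
      then have [measurable]: "(\<lambda>y. deriv (deriv f) (u t y)) \<in> borel_measurable borel"
        by simp
      show "(\<lambda>y. deriv (deriv f) (u t y) / 2 * (u\<^sub>x y)\<^sup>2) \<in> borel_measurable lborel"
        using borel_measurable_integrable[OF ux_int] by simp
      \<comment> \<open>By convexity the left side is the second derivative itself, and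
        \<open>B\<close> bounds its deviation from the value at 0.\<close>
      have "\<bar>deriv (deriv f) (u t y)\<bar> \<le> \<bar>B + deriv (deriv f) 0\<bar>" for y
        using B[of y] assms(4)[rule_format, of "u t y"] by linarith
      then show "AE y in lborel. norm (deriv (deriv f) (u t y) / 2 * (u\<^sub>x y)\<^sup>2)
          \<le> norm ((B + deriv (deriv f) 0) / 2 * (u\<^sub>x y)\<^sup>2)"
        by (intro AE_I2) (simp add: abs_mult mult_right_mono divide_right_mono)
    qed
    ultimately show ?thesis
      unfolding F_def[abs_def] by (rule Bochner_Integration.integrable_add)
  qed
  have out: "\<bar>y\<bar> > R" if "y \<ge> \<bar>R\<bar> + 1" for y
    using that by linarith
  \<comment> \<open>The point \<open>\<bar>R\<bar> + 1\<close> lies to the right of the support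
    whatever the sign of \<open>R\<close>; there the local terms of the equation vanish and only the
    nonlocal one remains.\<close>
  have "dx_inverse_helmholtz F (\<bar>R\<bar> + 1) = 0"
    using eq[of "\<bar>R\<bar> + 1"] ut_zero ux_zero out by (simp add: F_def[abs_def])
  then have "AE y in lborel. F y = 0"
    using F_supp out by (intro dx_inverse_helmholtz_zero_imp_AE_zero[OF F_int F_nonneg]) auto
  then have "AE y in lborel. u t y = 0"
  proof eventually_elim
    case (elim y)
    \<comment> \<open>Both summands of \<open>F\<close> are nonnegative, so each is 0 where
      \<open>F\<close> is.\<close>
    have "g (u t y) = 0"
      using elim assms(4,5) by (auto simp: F_def add_nonneg_eq_0_iff)
    then show ?case using assms(6) by simp
  qed
  then have "u t x\<^sub>0 = 0"
    by (rule continuous_AE_zero_imp_zero[OF u_cont])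
  with \<open>u t x\<^sub>0 \<noteq> 0\<close> show False ..
qed

end
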